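(* There exists a constant $C>0$ such that for all $s\ge 2$ and all sufficiently regular functions $u$ defined in a neighborhood of the hypersurface $\mathcal{M}^{\text{int}}_s$, the following estimate holds: $$ t^{3/2} \, |u(x)|\leq C \sum_{|J| \leq 2} \| L^J u\|_{L^2(\mathcal{M}^{\text{int}}_s)}, \qquad x\in\mathcal{M}^{\text{int}}_s. $$ Here, for a point of the hypersurface with spatial coordinate $x$, $t=\sqrt{s^2+|x|^2}$ and $u(x)$ denotes the value $u\big(\sqrt{s^2+|x|^2},x\big)$.
   Context: Work in $\mathbb{R}^{3+1}$ with coordinates $(t,x)=(t,x^1,x^2,x^3)$, $r=|x|$, $x_a=x^a$ for $a=1,2,3$. The interior hyperboloidal hypersurface is $$ \mathcal{M}^{\text{int}}_s=\{(t,x): t>0,\ t^2=s^2+r^2,\ r\le -1+s^2/2\}. $$ The Lorentz boosts are $L_a=x_a\partial_t+t\,\partial_a$, $a=1,2,3$, and $L^J$ denotes any $|J|$-order operator (composition of $|J|$ fields) formed from $L_1,L_2,L_3$; the sum runs over all such operators with $|J|\le 2$. The $L^2$ norm is taken with respect to the flat measure $dx$: $$ \|v\|_{L^2(\mathcal{M}^{\text{int}}_s)}^2=\int_{\{|x|\le -1+s^2/2\}}\big|v\big(\sqrt{s^2+|x|^2},x\big)\big|^2\,dx . $$ "Sufficiently regular" may be taken to mean smooth. *)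

theory Defs
  imports "HOL-Analysis.Analysis"
begin

text \<open>
  A point of the spacetime is a pair \<open>(t, x)\<close>; functions on it are total, and only their values
  on a given open set are meaningful.
\<close>

type_synonym spacetime = "real \<times> (real ^ 3)"

definition hyperboloid_int :: "real \<Rightarrow> spacetime set" where
  "hyperboloid_int s = {(t, x). t > 0 \<and> t\<^sup>2 = s\<^sup>2 + (norm x)\<^sup>2 \<and> norm x \<le> -1 + s\<^sup>2 / 2}"

text \<open>
  Class \<open>C\<^sup>k\<close> and smoothness, by iterated directional derivatives. The derivatives are taken in the
  whole space, so these are the usual notions when \<open>W\<close> is open.
\<close>

fun Ck_on :: "nat \<Rightarrow> 'a::euclidean_space set \<Rightarrow> ('a \<Rightarrow> real) \<Rightarrow> bool" where
  "Ck_on 0 W f \<longleftrightarrow> continuous_on W f"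
| "Ck_on (Suc k) W f \<longleftrightarrow>
     (\<forall>p\<in>W. f differentiable (at p)) \<and>
     (\<forall>v. Ck_on k W (\<lambda>p. frechet_derivative f (at p) v))"

definition smooth_on :: "'a::euclidean_space set \<Rightarrow> ('a \<Rightarrow> real) \<Rightarrow> bool" where
  "smooth_on W f \<longleftrightarrow> (\<forall>k. Ck_on k W f)"

definition partial_t :: "(spacetime \<Rightarrow> real) \<Rightarrow> spacetime \<Rightarrow> real" where
  "partial_t u p = frechet_derivative u (at p) (1, 0)"

definition partial_x :: "3 \<Rightarrow> (spacetime \<Rightarrow> real) \<Rightarrow> spacetime \<Rightarrow> real" where
  "partial_x a u p = frechet_derivative u (at p) (0, axis a 1)"

definition boost :: "3 \<Rightarrow> (spacetime \<Rightarrow> real) \<Rightarrow> spacetime \<Rightarrow> real" where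
  "boost a u = (\<lambda>(t, x). x $ a * partial_t u (t, x) + t * partial_x a u (t, x))"

text \<open>
  A multi-index is a word in the three boosts, since these do not commute:
  \<open>boosts [a, b] u = boost a (boost b u)\<close>. Its order is its length.
\<close>

definition boosts :: "3 list \<Rightarrow> (spacetime \<Rightarrow> real) \<Rightarrow> spacetime \<Rightarrow> real" where
  "boosts J u = foldr boost J u"

text \<open>
  The measure is the flat \<open>dx\<close> on the projection of the hypersurface to the spatial coordinates,
  not its induced surface measure.
\<close>

definition L2_norm_int :: "real \<Rightarrow> (spacetime \<Rightarrow> real) \<Rightarrow> real" where
  "L2_norm_int s v =
     sqrt (LINT x:{x. norm x \<le> -1 + s\<^sup>2 / 2}|lborel. \<bar>v (sqrt (s\<^sup>2 + (norm x)\<^sup>2), x)\<bar>\<^sup>2)"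

end

theory Submission
  imports Defs
begin

text \<open>
  Write \<open>\<tau>(x) = sqrt (s\<^sup>2 + |x|\<^sup>2)\<close> for the time on the hyperboloid and \<open>v\<^sub>J\<close> for the restriction of
  \<open>boosts J u\<close> to it, as a function of \<open>x\<close>. A boost is tangent to the hyperboloid and acts on
  restrictions as \<open>\<tau> \<partial>\<^sub>a\<close>; so the estimate is a Sobolev inequality \<open>H\<^sup>2 \<subseteq> L\<^sup>\<infinity>\<close> in three dimensions at
  the length scale \<open>t\<close> of the given point \<open>x\<close>, and \<open>t powr (3 / 2)\<close> is the square root of the volume
  of a region of that scale.

  The region is a closed ball \<open>D\<close> of radius \<open>t / 4\<close> which contains \<open>x\<close> and lies in the domain of
  integration, the ball of radius \<open>R = s\<^sup>2 / 2 - 1\<close>. It exists because \<open>s \<ge> 2\<close> gives \<open>R \<ge> 1\<close>, so that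
  \<open>t\<^sup>2 \<le> s\<^sup>2 + R\<^sup>2 = R\<^sup>2 + 2 R + 2 \<le> (4 R)\<^sup>2\<close>; the ball is pushed from \<open>x\<close> towards the origin to
  stay inside. Since \<open>\<tau>\<close> is 1-Lipschitz, it is at least \<open>t / 2\<close> on \<open>D\<close>, hence at least the distance
  from \<open>x\<close> to any point of \<open>D\<close>.

  For \<open>y\<close> in \<open>D\<close>, let \<open>g(l)\<close> be the value of the restriction of \<open>u\<close> at \<open>x + l (y - x)\<close>. Integration by parts with the
  cutoff \<open>(1 - l)\<^sup>2\<close> expresses \<open>g(0)\<close> as the integral of \<open>l ((1 - l)\<^sup>2 g)''\<close> over \<open>[0, 1]\<close>
  (\<open>abs_value_at_0_le_integral\<close>). As \<open>|y - x| \<le> \<tau>\<close> on the segment, \<open>g'\<close> and \<open>g''\<close> are bounded by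
  values of the \<open>v\<^sub>J\<close> without any weight, whence
  \<open>|u(t, x)| \<le> 5 \<Sum>\<^sub>J \<integral> l |v\<^sub>J(x + l (y - x))| dl\<close> (\<open>abs_restrict_le_segment_integral\<close>).

  It remains to average over \<open>y\<close> in \<open>D\<close>. For fixed \<open>l\<close>, Cauchy-Schwarz and the dilation by \<open>l\<close> about
  \<open>x\<close> bound the integral of \<open>|v\<^sub>J(x + l (y - x))|\<close> over \<open>y\<close> by
  \<open>l powr (- 3 / 2) * sqrt |D| * \<parallel>v\<^sub>J\<parallel>\<close>. The factor \<open>l\<close> makes this integrable at \<open>0\<close>, precisely because
  the dimension is below \<open>4\<close> (\<open>nn_integral_segment_average_le\<close>, \<open>sobolev_of_segment_bounds\<close>).
\<close>

section \<open>Smoothness of iterated boosts\<close>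


text \<open>
  The derivatives in the definition of \<open>C\<^sup>k\<close> are taken in the whole space, so openness is what makes
  the class depend only on the values on the set. The sum and product rules hold only on the set, and
  this lemma is what carries them into the induction.
\<close>

lemma Ck_on_cong:
  assumes "open W" "\<And>p. p \<in> W \<Longrightarrow> f p = g p" "Ck_on k W f"
  shows "Ck_on k W g"
  using assms(2,3)
proof (induction k arbitrary: f g)
  case 0
  then show ?case by (auto cong: continuous_on_cong)
next
  case (Suc k)
  have der: "(g has_derivative F) (at p)" if "p \<in> W" "(f has_derivative F) (at p)" for p F
    using has_derivative_transform_within_open[OF that(2) \<open>open W\<close> that(1)] Suc.prems(1) by auto
  have gd: "(g has_derivative frechet_derivative f (at p)) (at p)" if "p \<in> W" for p
    using der[OF that] Suc.prems(2) that by (simp add: frechet_derivative_works)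
  have eq: "frechet_derivative f (at p) = frechet_derivative g (at p)" if "p \<in> W" for p
    using frechet_derivative_at[OF gd[OF that]] .
  have "Ck_on k W (\<lambda>p. frechet_derivative g (at p) v)" for v
    using Suc.IH[of "\<lambda>p. frechet_derivative f (at p) v" "\<lambda>p. frechet_derivative g (at p) v"]
      Suc.prems(2) eq by auto
  moreover have "g differentiable (at p)" if "p \<in> W" for p
    using gd[OF that] differentiable_def by blast
  ultimately show ?case by simp
qed

lemma Ck_on_Suc_imp: "Ck_on (Suc k) W f \<Longrightarrow> Ck_on k W f"
proof (induction k arbitrary: f)
  case 0
  then show ?case
    by (auto intro!: continuous_at_imp_continuous_on differentiable_imp_continuous_within)
next
  case (Suc k)
  then show ?case by (auto simp del: Ck_on.simps(1))
qed

lemma Ck_on_const: "Ck_on k W (\<lambda>_. c)"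
  by (induction k arbitrary: c) auto

lemma Ck_on_bounded_linear:
  assumes "bounded_linear f"
  shows "Ck_on k W f"
proof (cases k)
  case 0
  then show ?thesis using assms by (simp add: linear_continuous_on)
next
  case (Suc m)
  have "frechet_derivative f (at p) = f" for p
    using frechet_derivative_at[OF bounded_linear_imp_has_derivative[OF assms, of "at p"]] by simp
  then show ?thesis
    using Suc assms by (auto simp: Ck_on_const bounded_linear_imp_differentiable)
qed

lemma Ck_on_add:
  assumes "open W" "Ck_on k W f" "Ck_on k W g"
  shows "Ck_on k W (\<lambda>p. f p + g p)"
  using assms(2,3)
proof (induction k arbitrary: f g)
  case 0
  then show ?case by (auto intro: continuous_on_add)
next
  case (Suc k)
  have eq: "frechet_derivative f (at p) v + frechet_derivative g (at p) v
      = frechet_derivative (\<lambda>p. f p + g p) (at p) v" if "p \<in> W" for p v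
    by (rule fun_cong[OF frechet_derivative_at])
       (use Suc.prems that in \<open>auto intro!: has_derivative_add simp: frechet_derivative_works\<close>)
  have "Ck_on k W (\<lambda>p. frechet_derivative (\<lambda>p. f p + g p) (at p) v)" for v
    by (rule Ck_on_cong[OF \<open>open W\<close> _
          Suc.IH[of "\<lambda>p. frechet_derivative f (at p) v" "\<lambda>p. frechet_derivative g (at p) v"]])
       (use Suc.prems eq in auto)
  then show ?case using Suc.prems by auto
qed

lemma Ck_on_mult:
  assumes "open W" "Ck_on k W f" "Ck_on k W g"
  shows "Ck_on k W (\<lambda>p. f p * g p)"
  using assms(2,3)
proof (induction k arbitrary: f g)
  case 0
  then show ?case by (auto intro: continuous_on_mult)
next
  case (Suc k)
  have eq: "f p * frechet_derivative g (at p) v + frechet_derivative f (at p) v * g p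
      = frechet_derivative (\<lambda>p. f p * g p) (at p) v" if "p \<in> W" for p v
    by (rule fun_cong[OF frechet_derivative_at])
       (use Suc.prems that in \<open>auto intro!: has_derivative_mult simp: frechet_derivative_works\<close>)
  have "Ck_on k W (\<lambda>p. f p * frechet_derivative g (at p) v + frechet_derivative f (at p) v * g p)" for v
    by (intro Ck_on_add Suc.IH assms) (use Suc.prems Ck_on_Suc_imp in auto)
  then have "Ck_on k W (\<lambda>p. frechet_derivative (\<lambda>p. f p * g p) (at p) v)" for v
    by (rule Ck_on_cong[OF \<open>open W\<close>, rotated]) (use eq in auto)
  then show ?case using Suc.prems by auto
qed

lemma smooth_on_boost:
  assumes "open W" "smooth_on W u"
  shows "smooth_on W (boost a u)"
  unfolding smooth_on_def
proof
  fix k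
  have u: "Ck_on (Suc k) W u" using assms(2) unfolding smooth_on_def by blast
  have bl: "bounded_linear (\<lambda>p::spacetime. snd p $ a)"
    by (rule bounded_linear_compose[OF bounded_linear_vec_nth bounded_linear_snd])
  have "boost a u = (\<lambda>p. snd p $ a * frechet_derivative u (at p) (1, 0)
        + fst p * frechet_derivative u (at p) (0, axis a 1))"
    by (auto simp: boost_def partial_t_def partial_x_def)
  then show "Ck_on k W (boost a u)"
    using u by (auto intro!: Ck_on_add Ck_on_mult assms(1)
        Ck_on_bounded_linear[OF bl] Ck_on_bounded_linear[OF bounded_linear_fst])
qed

lemma smooth_on_boosts:
  assumes "open W" "smooth_on W u"
  shows "smooth_on W (boosts J u)"
  using assms by (induction J) (auto simp: boosts_def smooth_on_boost)



section \<open>Boosts as derivatives along the hyperboloid\<close>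

definition hyperboloid_time :: "real \<Rightarrow> real^3 \<Rightarrow> real" where
  "hyperboloid_time s x = sqrt (s\<^sup>2 + (norm x)\<^sup>2)"

definition hyperboloid_restrict :: "real \<Rightarrow> (spacetime \<Rightarrow> 'a) \<Rightarrow> real^3 \<Rightarrow> 'a" where
  "hyperboloid_restrict s f x = f (hyperboloid_time s x, x)"

lemma hyperboloid_time_pos: "s \<noteq> 0 \<Longrightarrow> hyperboloid_time s x > 0"
  by (simp add: hyperboloid_time_def add_pos_nonneg)

lemma hyperboloid_time_along_line:
  assumes "s \<noteq> 0"
  shows "((\<lambda>l. hyperboloid_time s (x + l *\<^sub>R h)) has_real_derivative
      (x + l *\<^sub>R h) \<bullet> h / hyperboloid_time s (x + l *\<^sub>R h)) (at l)"
proof -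
  have "0 < s\<^sup>2 + (x + l *\<^sub>R h) \<bullet> (x + l *\<^sub>R h)"
    using assms by (simp add: add_pos_nonneg)
  then show ?thesis
    unfolding hyperboloid_time_def power2_norm_eq_inner
    by (auto intro!: derivative_eq_intros simp: has_field_derivative_def inner_commute field_simps)
qed

text \<open>
  The point \<open>(\<tau>(z), z)\<close> moves along the hyperboloid with velocity \<open>(z \<bullet> h / \<tau>, h)\<close>, which is
  \<open>1 / \<tau>\<close> times the combination of the boost vectors \<open>(z $ a, \<tau> axis a 1)\<close> with coefficients \<open>h $ a\<close>.
\<close>

lemma restrict_along_line:
  fixes x h :: "real^3" and l :: real
  defines "z \<equiv> x + l *\<^sub>R h"
  assumes "s \<noteq> 0" "f differentiable (at (hyperboloid_time s z, z))"
  shows "((\<lambda>l. hyperboloid_restrict s f (x + l *\<^sub>R h)) has_real_derivative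
      (\<Sum>a\<in>UNIV. h $ a * hyperboloid_restrict s (boost a f) z) / hyperboloid_time s z) (at l)"
proof -
  let ?\<tau> = "hyperboloid_time s"
  let ?f' = "frechet_derivative f (at (?\<tau> z, z))"
  have f': "(f has_derivative ?f') (at (?\<tau> z, z))"
    using assms(3) by (simp add: frechet_derivative_works)
  interpret f': bounded_linear ?f' using f' by (rule has_derivative_bounded_linear)
  have tp: "?\<tau> z > 0" using assms(2) by (rule hyperboloid_time_pos)
  have \<tau>': "((\<lambda>l. ?\<tau> (x + l *\<^sub>R h)) has_derivative (\<lambda>d. d * ((z \<bullet> h) / ?\<tau> z))) (at l)"
    using hyperboloid_time_along_line[OF assms(2), of x h l]
    unfolding has_field_derivative_def z_def by (rule has_derivative_eq_rhs) (simp add: fun_eq_iff)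
  have "((\<lambda>l. (?\<tau> (x + l *\<^sub>R h), x + l *\<^sub>R h)) has_derivative
      (\<lambda>d. (d * ((z \<bullet> h) / ?\<tau> z), d *\<^sub>R h))) (at l)"
    by (intro has_derivative_Pair \<tau>') (auto intro!: derivative_eq_intros)
  from diff_chain_at[OF this, of f ?f'] f'
  have "((\<lambda>l. f (?\<tau> (x + l *\<^sub>R h), x + l *\<^sub>R h)) has_derivative
      (\<lambda>d. ?f' (d * ((z \<bullet> h) / ?\<tau> z), d *\<^sub>R h))) (at l)"
    by (simp add: o_def z_def)
  moreover have "?f' (d * ((z \<bullet> h) / ?\<tau> z), d *\<^sub>R h)
      = (\<Sum>a\<in>UNIV. h $ a * boost a f (?\<tau> z, z)) / ?\<tau> z * d" for d
  proof -
    have "(d * ((z \<bullet> h) / ?\<tau> z), d *\<^sub>R h) = d *\<^sub>R ((z \<bullet> h / ?\<tau> z) *\<^sub>R (1, 0) + (0, h))"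
      by simp
    also have "(0::real, h) = (0, \<Sum>a\<in>UNIV. h $ a *\<^sub>R axis a 1)"
      using basis_expansion[of h] by (simp add: scalar_mult_eq_scaleR)
    also have "\<dots> = (\<Sum>a\<in>UNIV. h $ a *\<^sub>R (0, axis a 1))"
      by (simp add: sum_prod)
    finally have "?f' (d * ((z \<bullet> h) / ?\<tau> z), d *\<^sub>R h)
       = d * ((z \<bullet> h / ?\<tau> z) * ?f' (1, 0) + (\<Sum>a\<in>UNIV. h $ a * ?f' (0, axis a 1)))"
      by (simp only: f'.scaleR f'.add f'.sum real_scaleR_def)
    also have "\<dots> = (\<Sum>a\<in>UNIV. h $ a * boost a f (?\<tau> z, z)) / ?\<tau> z * d"
      using tp by (simp add: boost_def partial_t_def partial_x_def inner_vec_def sum_3 field_simps)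
    finally show ?thesis .
  qed
  ultimately show ?thesis
    unfolding has_field_derivative_def hyperboloid_restrict_def by (simp only:)
qed

section \<open>Point values from second derivatives along a segment\<close>

text \<open>
  Two integrations by parts give \<open>\<integral> l (\<eta> g)'' = \<eta>(0) g(0)\<close> over \<open>[0, 1]\<close> for a cutoff \<open>\<eta>\<close> which
  vanishes with its derivative at \<open>1\<close>; here \<open>\<eta>(l) = (1 - l)\<^sup>2\<close>. The weight \<open>l\<close> is what later
  compensates the concentration of all segments at their common starting point.
\<close>

lemma abs_value_at_0_le_integral:
  fixes g g' g'' \<phi> :: "real \<Rightarrow> real"
  assumes g': "\<And>l. l \<in> {0..1} \<Longrightarrow> (g has_real_derivative g' l) (at l within {0..1})"
    and g'': "\<And>l. l \<in> {0..1} \<Longrightarrow> (g' has_real_derivative g'' l) (at l within {0..1})"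
    and le: "\<And>l. l \<in> {0..1} \<Longrightarrow> 2 * \<bar>g l\<bar> + 4 * \<bar>g' l\<bar> + \<bar>g'' l\<bar> \<le> \<phi> l"
    and int: "(\<lambda>l. l * \<phi> l) integrable_on {0..1}"
  shows "\<bar>g 0\<bar> \<le> integral {0..1} (\<lambda>l. l * \<phi> l)"
proof -
  define F where "F = (\<lambda>l. l * (2 * g l - 4 * (1 - l) * g' l + (1 - l)\<^sup>2 * g'' l))"
  define P where "P = (\<lambda>l. l * (- 2 * (1 - l) * g l + (1 - l)\<^sup>2 * g' l) - (1 - l)\<^sup>2 * g l)"
  \<comment> \<open>\<open>F\<close> is \<open>l (\<eta> g)''\<close> and \<open>P\<close> is its antiderivative \<open>l (\<eta> g)' - \<eta> g\<close>.\<close>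
  have "(F has_integral (P 1 - P 0)) {0..1}"
  proof (rule fundamental_theorem_of_calculus)
    fix l :: real assume l: "l \<in> {0..1}"
    have "(P has_real_derivative F l) (at l within {0..1})"
      unfolding P_def F_def
      by (rule derivative_eq_intros g'[OF l] g''[OF l] refl)+ (simp add: algebra_simps power2_eq_square)
    then show "(P has_vector_derivative F l) (at l within {0..1})"
      by (simp add: has_real_derivative_iff_has_vector_derivative)
  qed simp
  then have F: "(F has_integral g 0) {0..1}" by (simp add: P_def)
  have "\<bar>F l\<bar> \<le> l * \<phi> l" if l: "l \<in> {0..1}" for l
  proof -
    have "\<bar>2 * g l - 4 * (1 - l) * g' l + (1 - l)\<^sup>2 * g'' l\<bar>
        \<le> 2 * \<bar>g l\<bar> + (1 - l) * (4 * \<bar>g' l\<bar>) + (1 - l)\<^sup>2 * \<bar>g'' l\<bar>"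
      using l
      by (intro order_trans[OF abs_triangle_ineq] add_mono order_trans[OF abs_triangle_ineq4],
          simp_all add: abs_mult, simp add: algebra_simps)
    also have "\<dots> \<le> 2 * \<bar>g l\<bar> + 4 * \<bar>g' l\<bar> + \<bar>g'' l\<bar>"
      using l by (intro add_mono mult_left_le_one_le) (auto intro: power_le_one)
    also have "\<dots> \<le> \<phi> l" using le[OF l] .
    finally show ?thesis using l by (simp add: F_def abs_mult mult_left_mono)
  qed
  then have "norm (integral {0..1} F) \<le> integral {0..1} (\<lambda>l. l * \<phi> l)"
    using F int by (intro integral_norm_bound_integral) auto
  then show ?thesis using F by (simp add: integral_unique)
qed

lemma sum_lists_length_le_2:
  fixes f :: "'a::finite list \<Rightarrow> 'b::comm_monoid_add"
  shows "(\<Sum>J | length J \<le> 2. f J) = f [] + (\<Sum>a\<in>UNIV. f [a]) + (\<Sum>a\<in>UNIV. \<Sum>b\<in>UNIV. f [a, b])"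
proof -
  have "{J :: 'a list. length J \<le> 2} = insert [] ((\<lambda>a. [a]) ` UNIV \<union> (\<lambda>(a, b). [a, b]) ` UNIV)"
    by (auto simp: le_Suc_eq numeral_2_eq_2 length_Suc_conv image_iff)
  then have "(\<Sum>J | length J \<le> 2. f J)
      = f [] + (sum f ((\<lambda>a. [a]) ` UNIV) + sum f ((\<lambda>(a, b). [a, b]) ` UNIV))"
    by (simp, subst sum.insert) (auto intro!: sum.union_disjoint arg_cong2[where f="(+)"])
  then show ?thesis
    by (simp add: sum.reindex inj_on_def case_prod_unfold sum.cartesian_product add.assoc
        UNIV_Times_UNIV[symmetric] del: UNIV_Times_UNIV)
qed

text \<open>
  The length of the segment is assumed to be at most \<open>\<tau>\<close> along it: each derivative along the
  segment costs a factor \<open>|h| / \<tau>\<close> relative to a boost, and so no factor at all. Differentiating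
  the weight \<open>1 / \<tau>\<close> in the second derivative yields a first-order term only, for which
  \<open>|\<tau>'| = |z \<bullet> h| / \<tau> \<le> \<tau>\<close> suffices. The \<open>5\<close> is the coefficient \<open>4\<close> of \<open>g'\<close> in
  \<open>abs_value_at_0_le_integral\<close> plus \<open>1\<close> for this term.
\<close>

lemma abs_restrict_le_segment_integral:
  fixes x h :: "real^3"
  defines "z \<equiv> \<lambda>l. x + l *\<^sub>R h"
  assumes "s \<noteq> 0"
    and small: "\<And>l. l \<in> {0..1} \<Longrightarrow> norm h \<le> hyperboloid_time s (z l)"
    and diff0: "\<And>l. l \<in> {0..1} \<Longrightarrow> u differentiable (at (hyperboloid_time s (z l), z l))"
    and diff1: "\<And>l a. l \<in> {0..1} \<Longrightarrow> boost a u differentiable (at (hyperboloid_time s (z l), z l))"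
    and cont: "\<And>J. length J \<le> 2 \<Longrightarrow>
      continuous_on {0..1} (\<lambda>l. hyperboloid_restrict s (boosts J u) (z l))"
  shows "\<bar>hyperboloid_restrict s u x\<bar> \<le>
    5 * (\<Sum>J | length J \<le> 2. integral {0..1} (\<lambda>l. l * \<bar>hyperboloid_restrict s (boosts J u) (z l)\<bar>))"
proof -
  define v where "v = (\<lambda>J l. hyperboloid_restrict s (boosts J u) (z l))"
  define \<tau> where "\<tau> = (\<lambda>l. hyperboloid_time s (z l))"
  define A where "A = (\<lambda>l. \<Sum>a\<in>UNIV. h $ a * v [a] l)"
  define A' where "A' = (\<lambda>l. \<Sum>a\<in>UNIV. h $ a * ((\<Sum>b\<in>UNIV. h $ b * v [b, a] l) / \<tau> l))"
  define \<phi> where "\<phi> = (\<lambda>l. 5 * (\<Sum>J | length J \<le> 2. \<bar>v J l\<bar>))"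
  have fin: "finite {J :: 3 list. length J \<le> 2}"
    using finite_lists_length_le[of "UNIV :: 3 set" 2] by simp
  have cont': "continuous_on {0..1} (\<lambda>l. l * \<bar>v J l\<bar>)" if "length J \<le> 2" for J
    unfolding v_def by (intro continuous_intros cont that)
  have \<phi>: "l * \<phi> l = 5 * (\<Sum>J | length J \<le> 2. l * \<bar>v J l\<bar>)" for l
    by (simp add: \<phi>_def sum_distrib_left mult.left_commute)
  have pos: "\<tau> l > 0" for l
    unfolding \<tau>_def using assms(2) by (rule hyperboloid_time_pos)
  have h: "\<bar>h $ a\<bar> \<le> \<tau> l" if "l \<in> {0..1}" for a l
    using component_le_norm_cart[of h a] small[OF that] by (simp add: \<tau>_def)
  \<comment> \<open>\<open>A / \<tau>\<close> is the first derivative of \<open>v []\<close> along the segment, and \<open>A'\<close> is the derivative of \<open>A\<close>.\<close>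
  have A_le: "\<bar>A l\<bar> \<le> \<tau> l * (\<Sum>a\<in>UNIV. \<bar>v [a] l\<bar>)" if "l \<in> {0..1}" for l
    unfolding A_def sum_distrib_left
    by (rule order_trans[OF sum_abs]) (auto intro!: sum_mono mult_right_mono h that simp: abs_mult)
  have A'_le: "\<bar>A' l\<bar> \<le> \<tau> l * (\<Sum>a\<in>UNIV. \<Sum>b\<in>UNIV. \<bar>v [b, a] l\<bar>)" if "l \<in> {0..1}" for l
  proof -
    have "\<bar>\<Sum>b\<in>UNIV. h $ b * v [b, a] l\<bar> \<le> (\<Sum>b\<in>UNIV. \<bar>v [b, a] l\<bar>) * \<tau> l" for a
      unfolding sum_distrib_right
      by (rule order_trans[OF sum_abs])
        (auto intro!: sum_mono mult_left_mono h that simp: abs_mult mult.commute[of "\<bar>h $ _\<bar>"])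
    then have "\<bar>(\<Sum>b\<in>UNIV. h $ b * v [b, a] l) / \<tau> l\<bar> \<le> (\<Sum>b\<in>UNIV. \<bar>v [b, a] l\<bar>)" for a
      using pos[of l] by (simp add: pos_divide_le_eq)
    then show ?thesis
      unfolding A'_def
      by (subst sum_distrib_left, intro order_trans[OF sum_abs] sum_mono)
        (subst abs_mult, intro mult_mono, use h that less_imp_le[OF pos[of l]] in auto)
  qed
  have "\<bar>v [] 0\<bar> \<le> integral {0..1} (\<lambda>l. l * \<phi> l)"
  proof (rule abs_value_at_0_le_integral)
    fix l :: real assume l: "l \<in> {0..1}"
    have "((\<lambda>l. v [] l) has_real_derivative A l / \<tau> l) (at l)"
      using restrict_along_line[OF assms(2), of u x l h] diff0[OF l]
      by (simp add: v_def A_def \<tau>_def z_def boosts_def)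
    then show "(v [] has_real_derivative A l / \<tau> l) (at l within {0..1})"
      by (rule has_field_derivative_at_within)
    have "(A has_real_derivative A' l) (at l)"
      unfolding A_def A'_def
    proof (intro DERIV_sum DERIV_cmult)
      fix a
      show "((\<lambda>l. v [a] l) has_real_derivative (\<Sum>b\<in>UNIV. h $ b * v [b, a] l) / \<tau> l) (at l)"
        using restrict_along_line[OF assms(2), of "boost a u" x l h] diff1[OF l]
        by (simp add: v_def \<tau>_def z_def boosts_def)
    qed
    moreover have "(\<tau> has_real_derivative (z l \<bullet> h) / \<tau> l) (at l)"
      unfolding \<tau>_def z_def by (rule hyperboloid_time_along_line[OF assms(2)])
    ultimately have "((\<lambda>l. A l / \<tau> l) has_real_derivative
        (A' l * \<tau> l - A l * ((z l \<bullet> h) / \<tau> l)) / (\<tau> l * \<tau> l)) (at l)"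
      using pos[of l] by (intro DERIV_divide) auto
    then show "((\<lambda>l. A l / \<tau> l) has_real_derivative
        (A' l * \<tau> l - A l * ((z l \<bullet> h) / \<tau> l)) / (\<tau> l * \<tau> l)) (at l within {0..1})"
      by (rule has_field_derivative_at_within)
    have "norm (z l) \<le> \<tau> l"
      unfolding \<tau>_def hyperboloid_time_def by (rule real_le_rsqrt) simp
    then have "\<bar>z l \<bullet> h\<bar> \<le> \<tau> l * \<tau> l"
      using small[OF l] Cauchy_Schwarz_ineq2[of "z l" h] pos[of l]
      by (intro order_trans[OF Cauchy_Schwarz_ineq2] mult_mono) (auto simp: \<tau>_def)
    then have zh: "\<bar>(z l \<bullet> h) / \<tau> l\<bar> \<le> \<tau> l"
      using pos[of l] by (simp add: pos_divide_le_eq)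
    have "\<bar>A' l * \<tau> l - A l * ((z l \<bullet> h) / \<tau> l)\<bar> \<le> \<bar>A' l\<bar> * \<tau> l + \<bar>A l\<bar> * \<tau> l"
      using zh pos[of l]
      by (intro order_trans[OF abs_triangle_ineq4] add_mono)
        (simp_all add: abs_mult mult_left_mono del: times_divide_eq_right)
    also have "\<dots> \<le> (\<tau> l * (\<Sum>a\<in>UNIV. \<Sum>b\<in>UNIV. \<bar>v [b, a] l\<bar>)) * \<tau> l + (\<tau> l * (\<Sum>a\<in>UNIV. \<bar>v [a] l\<bar>)) * \<tau> l"
      using A_le[OF l] A'_le[OF l] pos[of l] by (intro add_mono mult_right_mono) auto
    also have "\<dots> = ((\<Sum>a\<in>UNIV. \<Sum>b\<in>UNIV. \<bar>v [b, a] l\<bar>) + (\<Sum>a\<in>UNIV. \<bar>v [a] l\<bar>)) * (\<tau> l * \<tau> l)"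
      by (simp add: algebra_simps)
    finally have second: "\<bar>(A' l * \<tau> l - A l * ((z l \<bullet> h) / \<tau> l)) / (\<tau> l * \<tau> l)\<bar>
        \<le> (\<Sum>a\<in>UNIV. \<Sum>b\<in>UNIV. \<bar>v [b, a] l\<bar>) + (\<Sum>a\<in>UNIV. \<bar>v [a] l\<bar>)"
      using pos[of l] by (simp add: pos_divide_le_eq abs_mult)
    have first: "\<bar>A l / \<tau> l\<bar> \<le> (\<Sum>a\<in>UNIV. \<bar>v [a] l\<bar>)"
      using A_le[OF l] pos[of l] by (simp add: pos_divide_le_eq mult.commute)
    have total: "\<phi> l = 5 * \<bar>v [] l\<bar> + 5 * (\<Sum>a\<in>UNIV. \<bar>v [a] l\<bar>)
        + 5 * (\<Sum>a\<in>UNIV. \<Sum>b\<in>UNIV. \<bar>v [b, a] l\<bar>)"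
      using sum.swap[of "\<lambda>a b. \<bar>v [b, a] l\<bar>" UNIV UNIV]
      by (simp add: \<phi>_def sum_lists_length_le_2)
    have nonneg: "0 \<le> (\<Sum>a\<in>UNIV. \<Sum>b\<in>UNIV. \<bar>v [b, a] l\<bar>)"
      by (intro sum_nonneg) auto
    have combine: "2 * p + 4 * q + r \<le> c"
      if "r \<le> S2 + S1" "q \<le> S1" "c = 5 * p + 5 * S1 + 5 * S2" "0 \<le> S2" "0 \<le> p"
      for p q r c S1 S2 :: real
      using that by linarith
    show "2 * \<bar>v [] l\<bar> + 4 * \<bar>A l / \<tau> l\<bar>
        + \<bar>(A' l * \<tau> l - A l * ((z l \<bullet> h) / \<tau> l)) / (\<tau> l * \<tau> l)\<bar> \<le> \<phi> l"
      by (rule combine[OF second first total nonneg abs_ge_zero])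
  next
    show "(\<lambda>l. l * \<phi> l) integrable_on {0..1}"
      unfolding \<phi>
      by (intro integrable_continuous_real continuous_intros cont') auto
  qed
  also have "\<dots> = 5 * (\<Sum>J | length J \<le> 2. integral {0..1} (\<lambda>l. l * \<bar>v J l\<bar>))"
    unfolding \<phi> integral_mult_right
    by (subst integral_sum) (auto intro!: fin integrable_continuous_real cont')
  finally show ?thesis
    by (simp add: v_def boosts_def z_def)
qed

section \<open>Averaging over a region in dimension at most three\<close>

lemma nn_integral_dilate:
  fixes f :: "'a::euclidean_space \<Rightarrow> ennreal"
  assumes [measurable]: "f \<in> borel_measurable borel" and "l > 0"
  shows "(\<integral>\<^sup>+y. f (x + l *\<^sub>R (y - x)) \<partial>lborel) = ennreal (l powr - DIM('a)) * (\<integral>\<^sup>+z. f z \<partial>lborel)"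
proof -
  have "(\<integral>\<^sup>+z. f z \<partial>lborel)
      = (\<integral>\<^sup>+z. f z \<partial>density (distr lborel borel (\<lambda>y. (x - l *\<^sub>R x) + l *\<^sub>R y)) (\<lambda>_. ennreal (\<bar>l\<bar> ^ DIM('a))))"
    using lborel_affine[of l "x - l *\<^sub>R x"] \<open>l > 0\<close> by simp
  also have "\<dots> = ennreal (l ^ DIM('a)) * (\<integral>\<^sup>+y. f (x + l *\<^sub>R (y - x)) \<partial>lborel)"
    using \<open>l > 0\<close>
    by (simp add: nn_integral_density nn_integral_distr nn_integral_cmult algebra_simps)
  finally show ?thesis
    using \<open>l > 0\<close>
    by (simp add: powr_minus powr_realpow mult.assoc[symmetric] ennreal_mult[symmetric])
qed

lemma le_ennreal_if_power2_le:
  assumes "(a::ennreal)\<^sup>2 \<le> ennreal (b\<^sup>2)" "b \<ge> 0"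
  shows "a \<le> ennreal b"
proof (cases a)
  case (real r)
  then show ?thesis
    using assms by (auto simp: ennreal_power intro!: ennreal_leI power2_le_imp_le)
next
  case top
  then show ?thesis using assms(1) by (simp add: top_unique power2_eq_square ennreal_top_mult)
qed

text \<open>
  For fixed \<open>l\<close>, composing \<open>\<Phi>\<close> with the dilation by \<open>l\<close> multiplies the square of its \<open>L\<^sup>2\<close> norm by
  \<open>l powr (- n)\<close> with \<open>n = DIM('a)\<close>, so Cauchy-Schwarz on \<open>D\<close> bounds the average by
  \<open>l powr (- n / 2) * m * N\<close>. With the weight \<open>l\<close> the remaining power \<open>1 - n / 2\<close> exceeds \<open>- 1\<close>
  if and only if \<open>n < 4\<close>, and its integral over \<open>[0, 1]\<close> is \<open>2 / (4 - n)\<close>.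
\<close>

lemma nn_integral_segment_average_le:
  fixes \<Phi> :: "'a::euclidean_space \<Rightarrow> ennreal" and m N :: real
  assumes dim: "DIM('a) < 4"
    and [measurable]: "\<Phi> \<in> borel_measurable borel" "D \<in> sets borel"
    and m: "emeasure lborel D = ennreal (m\<^sup>2)" "m \<ge> 0"
    and N: "(\<integral>\<^sup>+z. (\<Phi> z)\<^sup>2 \<partial>lborel) \<le> ennreal (N\<^sup>2)" "N \<ge> 0"
  shows "(\<integral>\<^sup>+y. (\<integral>\<^sup>+l. ennreal l * \<Phi> (x + l *\<^sub>R (y - x)) * indicator {0..1} l \<partial>lborel)
      * indicator D y \<partial>lborel) \<le> ennreal (2 / (4 - real DIM('a)) * (m * N))"
proof -
  let ?n = "real DIM('a)"
  have average: "(\<integral>\<^sup>+y. \<Phi> (x + l *\<^sub>R (y - x)) * indicator D y \<partial>lborel)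
      \<le> ennreal (l powr (- ?n / 2) * (m * N))" if "l > 0" for l
  proof (rule le_ennreal_if_power2_le)
    have "(\<integral>\<^sup>+y. \<Phi> (x + l *\<^sub>R (y - x)) * indicator D y \<partial>lborel)\<^sup>2
        \<le> (\<integral>\<^sup>+y. (\<Phi> (x + l *\<^sub>R (y - x)))\<^sup>2 \<partial>lborel) * (\<integral>\<^sup>+y. (indicator D y)\<^sup>2 \<partial>lborel)"
      by (rule Cauchy_Schwarz_nn_integral) auto
    also have "(\<integral>\<^sup>+y. (indicator D y)\<^sup>2 \<partial>lborel) = ennreal (m\<^sup>2)"
      using m(1) by (simp add: power2_eq_square indicator_inter_arith[symmetric])
    also have "(\<integral>\<^sup>+y. (\<Phi> (x + l *\<^sub>R (y - x)))\<^sup>2 \<partial>lborel)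
        = ennreal (l powr - ?n) * (\<integral>\<^sup>+z. (\<Phi> z)\<^sup>2 \<partial>lborel)"
      using that nn_integral_dilate[of "\<lambda>z. (\<Phi> z)\<^sup>2" l x] by simp
    also have "\<dots> * ennreal (m\<^sup>2) \<le> ennreal (l powr - ?n) * ennreal (N\<^sup>2) * ennreal (m\<^sup>2)"
      by (intro mult_right_mono mult_left_mono N) auto
    also have "\<dots> = ennreal ((l powr (- ?n / 2) * (m * N))\<^sup>2)"
      using that
      by (simp add: ennreal_mult[symmetric] power_mult_distrib powr_power mult_ac)
    finally show "(\<integral>\<^sup>+y. \<Phi> (x + l *\<^sub>R (y - x)) * indicator D y \<partial>lborel)\<^sup>2
        \<le> ennreal ((l powr (- ?n / 2) * (m * N))\<^sup>2)" .
  qed (use m N in auto)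
  \<comment> \<open>The order of integration is exchanged so that the bound can be applied for each \<open>l\<close>.\<close>
  have "(\<integral>\<^sup>+y. (\<integral>\<^sup>+l. ennreal l * \<Phi> (x + l *\<^sub>R (y - x)) * indicator {0..1} l \<partial>lborel)
      * indicator D y \<partial>lborel)
    = (\<integral>\<^sup>+y. (\<integral>\<^sup>+l. ennreal l * \<Phi> (x + l *\<^sub>R (y - x)) * indicator {0..1} l * indicator D y \<partial>lborel) \<partial>lborel)"
    by (intro nn_integral_cong nn_integral_multc[symmetric]) auto
  also have "\<dots> = (\<integral>\<^sup>+l. (\<integral>\<^sup>+y. ennreal l * \<Phi> (x + l *\<^sub>R (y - x)) * indicator {0..1} l * indicator D y \<partial>lborel) \<partial>lborel)"
    by (rule lborel_pair.Fubini') measurable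
  also have "\<dots> = (\<integral>\<^sup>+l. (ennreal l * indicator {0..1} l) *
      (\<integral>\<^sup>+y. \<Phi> (x + l *\<^sub>R (y - x)) * indicator D y \<partial>lborel) \<partial>lborel)"
    by (subst nn_integral_cmult[symmetric]) (auto simp: mult_ac)
  also have "\<dots> \<le> (\<integral>\<^sup>+l. ennreal (m * N) * (ennreal (l powr (1 - ?n / 2)) * indicator {0..1} l) \<partial>lborel)"
  proof (rule nn_integral_mono)
    fix l :: real
    show "(ennreal l * indicator {0..1} l) * (\<integral>\<^sup>+y. \<Phi> (x + l *\<^sub>R (y - x)) * indicator D y \<partial>lborel)
        \<le> ennreal (m * N) * (ennreal (l powr (1 - ?n / 2)) * indicator {0..1} l)"
    proof (cases "0 < l \<and> l \<le> 1")
      case True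
      have "ennreal l * (\<integral>\<^sup>+y. \<Phi> (x + l *\<^sub>R (y - x)) * indicator D y \<partial>lborel)
          \<le> ennreal l * ennreal (l powr (- ?n / 2) * (m * N))"
        by (intro mult_left_mono average) (use True in auto)
      also have "\<dots> = ennreal (m * N * l powr (1 - ?n / 2))"
        using True m N powr_add[of l 1 "- ?n / 2"] by (simp add: ennreal_mult[symmetric] mult_ac)
      finally show ?thesis
        using True m N by (simp add: ennreal_mult)
    qed (auto simp: indicator_def)
  qed
  also have "\<dots> = ennreal (m * N) * ennreal (1 powr (1 - ?n / 2 + 1) / (1 - ?n / 2 + 1))"
    using has_integral_powr_from_0[of "1 - ?n / 2" 1] dim
    by (subst nn_integral_cmult) (auto simp: nn_integral_has_integral_lebesgue')
  also have "\<dots> = ennreal (2 / (4 - real DIM('a)) * (m * N))"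
    using dim m N by (simp add: ennreal_mult[symmetric] field_simps)
  finally show ?thesis .
qed

text \<open>
  The bound on \<open>w\<close> is integrated over \<open>y\<close> in \<open>D\<close>, which produces the volume of \<open>D\<close> on the left and
  its square root on the right. Extending each \<open>v i\<close> by zero outside \<open>D\<close> does not change it on the
  segments, because \<open>D\<close> is star-shaped about \<open>x\<close>, and makes its \<open>L\<^sup>2\<close> norm over the whole space the
  norm over \<open>D\<close>.
\<close>

lemma sobolev_of_segment_bounds:
  fixes v :: "'i \<Rightarrow> 'a::euclidean_space \<Rightarrow> real"
  assumes dim: "DIM('a) < 4" and "compact D" and "finite I" and "K \<ge> 0" and "w \<ge> 0"
    and star: "\<And>y l. y \<in> D \<Longrightarrow> l \<in> {0..1} \<Longrightarrow> x + l *\<^sub>R (y - x) \<in> D"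
    and cont: "\<And>i. i \<in> I \<Longrightarrow> continuous_on D (v i)"
    and bound: "\<And>y. y \<in> D \<Longrightarrow> w \<le> K * (\<Sum>i\<in>I. integral {0..1} (\<lambda>l. l * \<bar>v i (x + l *\<^sub>R (y - x))\<bar>))"
  shows "sqrt (measure lborel D) * w
    \<le> 2 / (4 - real DIM('a)) * K * (\<Sum>i\<in>I. sqrt (LINT z:D|lborel. \<bar>v i z\<bar>\<^sup>2))"
proof -
  define m where "m = sqrt (measure lborel D)"
  define N where "N = (\<lambda>i. sqrt (LINT z:D|lborel. \<bar>v i z\<bar>\<^sup>2))"
  define \<Phi> where "\<Phi> = (\<lambda>i z. ennreal \<bar>indicator D z *\<^sub>R v i z\<bar>)"
  define S where "S = (\<lambda>i y. \<integral>\<^sup>+l. ennreal l * \<Phi> i (x + l *\<^sub>R (y - x)) * indicator {0..1} l \<partial>lborel)"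
  have D [measurable]: "D \<in> sets borel" using \<open>compact D\<close> by (simp add: borel_compact)
  have fin: "emeasure lborel D < \<infinity>"
    using \<open>compact D\<close> by (intro emeasure_bounded_finite compact_imp_bounded)
  have m0: "m \<ge> 0" and m: "emeasure lborel D = ennreal (m\<^sup>2)"
    using fin by (auto simp: m_def emeasure_eq_ennreal_measure)
  have N0: "N i \<ge> 0" for i
    by (simp add: N_def set_lebesgue_integral_def)
  have \<Phi>_meas [measurable]: "\<Phi> i \<in> borel_measurable borel" if "i \<in> I" for i
    using borel_measurable_integrable[OF borel_integrable_compact[OF \<open>compact D\<close> cont[OF that]]]
    by (simp add: \<Phi>_def)
  have \<Phi>2: "(\<integral>\<^sup>+z. (\<Phi> i z)\<^sup>2 \<partial>lborel) \<le> ennreal ((N i)\<^sup>2)" if "i \<in> I" for i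
  proof -
    have "integrable lborel (\<lambda>z. indicator D z *\<^sub>R \<bar>v i z\<bar>\<^sup>2)"
      by (intro borel_integrable_compact continuous_intros cont that assms)
    then have "(\<integral>\<^sup>+z. ennreal (indicator D z *\<^sub>R \<bar>v i z\<bar>\<^sup>2) \<partial>lborel) = ennreal ((N i)\<^sup>2)"
      by (subst nn_integral_eq_integral) (auto simp: N_def set_lebesgue_integral_def)
    moreover have "(\<Phi> i z)\<^sup>2 = ennreal (indicator D z *\<^sub>R \<bar>v i z\<bar>\<^sup>2)" for z
      by (auto simp: \<Phi>_def ennreal_power indicator_def)
    ultimately show ?thesis by simp
  qed
  have S_meas [measurable]: "S i \<in> borel_measurable borel" if [simp]: "i \<in> I" for i
    unfolding S_def by measurable
  have S: "ennreal (integral {0..1} (\<lambda>l. l * \<bar>v i (x + l *\<^sub>R (y - x))\<bar>)) = S i y"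
    if "i \<in> I" "y \<in> D" for i y
  proof -
    have "continuous_on {0..1} (\<lambda>l. v i (x + l *\<^sub>R (y - x)))"
      by (rule continuous_on_compose2[OF cont[OF that(1)]]) (auto intro!: continuous_intros star that)
    then have "(\<lambda>l. l * \<bar>v i (x + l *\<^sub>R (y - x))\<bar>) integrable_on {0..1}"
      by (intro integrable_continuous_real continuous_intros)
    then have "(\<integral>\<^sup>+l. ennreal (l * \<bar>v i (x + l *\<^sub>R (y - x))\<bar>) * indicator {0..1} l \<partial>lborel)
        = ennreal (integral {0..1} (\<lambda>l. l * \<bar>v i (x + l *\<^sub>R (y - x))\<bar>))"
      by (intro nn_integral_has_integral_lebesgue') auto
    moreover have "ennreal (l * \<bar>v i (x + l *\<^sub>R (y - x))\<bar>) * indicator {0..1} l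
        = ennreal l * \<Phi> i (x + l *\<^sub>R (y - x)) * indicator {0..1} l" for l
      using star[OF that(2), of l] by (auto simp: \<Phi>_def ennreal_mult indicator_def)
    ultimately show ?thesis by (simp add: S_def)
  qed
  have "ennreal (w * m\<^sup>2) = (\<integral>\<^sup>+y. ennreal w * indicator D y \<partial>lborel)"
    using \<open>w \<ge> 0\<close> by (simp add: nn_integral_cmult_indicator m ennreal_mult)
  also have "\<dots> \<le> (\<integral>\<^sup>+y. (\<Sum>i\<in>I. ennreal K * (S i y * indicator D y)) \<partial>lborel)"
  proof (rule nn_integral_mono)
    fix y
    show "ennreal w * indicator D y \<le> (\<Sum>i\<in>I. ennreal K * (S i y * indicator D y))"
    proof (cases "y \<in> D")
      case True
      have nn: "0 \<le> integral {0..1} (\<lambda>l. l * \<bar>v i (x + l *\<^sub>R (y - x))\<bar>)" for i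
        by (cases "(\<lambda>l. l * \<bar>v i (x + l *\<^sub>R (y - x))\<bar>) integrable_on {0..1}")
          (auto intro: integral_nonneg simp: not_integrable_integral)
      have "ennreal w \<le> ennreal (K * (\<Sum>i\<in>I. integral {0..1} (\<lambda>l. l * \<bar>v i (x + l *\<^sub>R (y - x))\<bar>)))"
        by (rule ennreal_leI[OF bound[OF True]])
      also have "\<dots> = ennreal K * (\<Sum>i\<in>I. S i y)"
        using \<open>K \<ge> 0\<close> True by (simp add: ennreal_mult' sum_ennreal[OF nn, symmetric] S cong: sum.cong)
      finally show ?thesis using True by (simp add: sum_distrib_left)
    qed simp
  qed
  also have "\<dots> = (\<Sum>i\<in>I. ennreal K * (\<integral>\<^sup>+y. S i y * indicator D y \<partial>lborel))"
    by (subst nn_integral_sum) (auto intro!: sum.cong nn_integral_cmult)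
  also have "\<dots> \<le> (\<Sum>i\<in>I. ennreal K * ennreal (2 / (4 - real DIM('a)) * (m * N i)))"
    unfolding S_def
    by (intro sum_mono mult_left_mono nn_integral_segment_average_le dim m m0 N0 \<Phi>2 D \<Phi>_meas) auto
  also have "\<dots> = ennreal (2 / (4 - real DIM('a)) * K * (\<Sum>i\<in>I. N i) * m)"
    using \<open>K \<ge> 0\<close> dim m0 N0
    by (simp add: ennreal_mult[symmetric] sum_ennreal sum_distrib_left sum_distrib_right sum_divide_distrib mult_ac)
  finally have "w * m\<^sup>2 \<le> 2 / (4 - real DIM('a)) * K * (\<Sum>i\<in>I. N i) * m"
    using \<open>K \<ge> 0\<close> dim m0 N0 by (subst (asm) ennreal_le_iff) (auto intro!: mult_nonneg_nonneg sum_nonneg divide_nonneg_nonneg)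
  then have "(m * w) * m \<le> 2 / (4 - real DIM('a)) * K * (\<Sum>i\<in>I. N i) * m"
    by (simp add: power2_eq_square mult_ac)
  moreover have "0 \<le> 2 / (4 - real DIM('a)) * K * (\<Sum>i\<in>I. N i)"
    using \<open>K \<ge> 0\<close> dim N0 by (auto intro!: mult_nonneg_nonneg sum_nonneg divide_nonneg_nonneg)
  ultimately have "m * w \<le> 2 / (4 - real DIM('a)) * K * (\<Sum>i\<in>I. N i)"
  proof (cases "m = 0")
    case False
    then have "m > 0" using m0 by simp
    show ?thesis by (rule mult_right_le_imp_le) fact+
  qed simp
  then show ?thesis by (simp add: m_def N_def)
qed

section \<open>The estimate on the interior hyperboloid\<close>

text \<open>
  The constant on the left is \<open>sqrt |D| / t powr (3 / 2)\<close> for the ball \<open>D\<close> of radius \<open>t / 4\<close>, and the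
  \<open>10\<close> on the right is the \<open>5\<close> of \<open>abs_restrict_le_segment_integral\<close> times \<open>2 / (4 - 3)\<close>.
\<close>

lemma sobolev_at_hyperboloid_point:
  assumes s: "s \<ge> 2" and W: "open W" "hyperboloid_int s \<subseteq> W" and u: "smooth_on W u"
    and tx: "(t, x) \<in> hyperboloid_int s"
  shows "sqrt (unit_ball_vol 3 / 64) * (t powr (3 / 2) * \<bar>u (t, x)\<bar>)
    \<le> 10 * (\<Sum>J | length J \<le> 2. L2_norm_int s (boosts J u))"
proof -
  define R where "R = -1 + s\<^sup>2 / 2"
  define \<rho> where "\<rho> = t / 4"
  define c where "c = (1 - \<rho> / R) *\<^sub>R x"
  define v where "v = (\<lambda>J. hyperboloid_restrict s (boosts J u))"
  define D where "D = cball c \<rho>"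
  have t: "t > 0" "t\<^sup>2 = s\<^sup>2 + (norm x)\<^sup>2" and x: "norm x \<le> R"
    using tx by (auto simp: hyperboloid_int_def R_def)
  have t_eq: "t = hyperboloid_time s x"
    using t by (simp add: hyperboloid_time_def real_sqrt_unique)
  have s4: "s\<^sup>2 \<ge> 2\<^sup>2" using s by (intro power_mono) auto
  then have R: "R \<ge> 1" by (simp add: R_def)
  have "t\<^sup>2 \<le> (4 * R)\<^sup>2"
  proof -
    have "(norm x)\<^sup>2 \<le> R\<^sup>2" using x by (intro power_mono) auto
    moreover have "R \<le> R\<^sup>2" using R by (simp add: power2_eq_square)
    moreover have "s\<^sup>2 = 2 * R + 2" by (simp add: R_def)
    moreover have "(4 * R)\<^sup>2 = 16 * R\<^sup>2" by (simp add: power_mult_distrib)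
    ultimately show ?thesis using t(2) R by linarith
  qed
  then have "t \<le> 4 * R" using R by (intro power2_le_imp_le[of t]) auto
  then have \<rho>: "0 < \<rho>" "\<rho> \<le> R" using t(1) by (auto simp: \<rho>_def)
  \<comment> \<open>The factor in \<open>c\<close> maps the ball of radius \<open>R\<close> onto that of radius \<open>R - \<rho>\<close> and moves \<open>x\<close> by at most \<open>\<rho>\<close>.\<close>
  have "norm c \<le> R - \<rho>"
  proof -
    have "norm c = (1 - \<rho> / R) * norm x" using \<rho> R by (simp add: c_def)
    also have "\<dots> \<le> (1 - \<rho> / R) * R" using \<rho> R x by (intro mult_left_mono) auto
    also have "\<dots> = R - \<rho>" using R by (simp add: left_diff_distrib)
    finally show ?thesis .
  qed
  then have D_sub: "D \<subseteq> cball 0 R"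
    unfolding D_def by (subst cball_subset_cball_iff) (auto simp: dist_norm)
  have "x - c = (\<rho> / R) *\<^sub>R x" by (simp add: c_def algebra_simps)
  then have "norm (x - c) = \<rho> * (norm x / R)" using \<rho> R by simp
  also have "\<dots> \<le> \<rho>" using \<rho> x R by (intro mult_left_le) auto
  finally have xD: "x \<in> D" by (simp add: D_def dist_norm norm_minus_commute)
  have star: "x + l *\<^sub>R (y - x) \<in> D" if "y \<in> D" "l \<in> {0..1}" for y l
  proof -
    have "x + l *\<^sub>R (y - x) = (1 - l) *\<^sub>R x + l *\<^sub>R y" by (simp add: algebra_simps)
    then show ?thesis
      using convexD_alt[OF convex_cball, of x c \<rho> y l] xD that by (simp add: D_def)
  qed
  have inW: "(hyperboloid_time s z, z) \<in> W" if "norm z \<le> R" for z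
    using that s hyperboloid_time_pos[of s z] W(2)
    by (auto simp: hyperboloid_int_def R_def hyperboloid_time_def)
  have Ck: "Ck_on k W (boosts J u)" for k J
    using smooth_on_boosts[OF W(1) u] by (simp add: smooth_on_def)
  have diff: "boosts J u differentiable (at (hyperboloid_time s z, z))" if "norm z \<le> R" for z J
    using Ck[of "Suc 0" J] inW[OF that] by simp
  have cont: "continuous_on (cball 0 R) (v J)" for J
  proof -
    have "continuous_on W (boosts J u)" using Ck[of 0 J] by simp
    then show ?thesis
      unfolding v_def hyperboloid_restrict_def
      by (rule continuous_on_compose2)
        (auto simp: hyperboloid_time_def[abs_def] intro!: continuous_intros inW[unfolded hyperboloid_time_def])
  qed
  have bound: "\<bar>u (t, x)\<bar> \<le> 5 * (\<Sum>J | length J \<le> 2.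
      integral {0..1} (\<lambda>l. l * \<bar>v J (x + l *\<^sub>R (y - x))\<bar>))" if y: "y \<in> D" for y
  proof -
    have R_seg: "norm (x + l *\<^sub>R (y - x)) \<le> R" if "l \<in> {0..1}" for l
      using star[OF y that] D_sub by auto
    have h: "norm (y - x) \<le> t / 2"
      using norm_triangle_le_diff[of "y - c" "x - c" "t / 2"] xD y
      by (simp add: D_def dist_norm norm_minus_commute \<rho>_def)
    have small: "norm (y - x) \<le> hyperboloid_time s (x + l *\<^sub>R (y - x))" if l: "l \<in> {0..1}" for l
    proof -
      \<comment> \<open>Reading \<open>\<tau>\<close> as a norm on the spacetime makes its Lipschitz bound the triangle inequality.\<close>
      have time_norm: "hyperboloid_time s z = norm (s, z)" for z
        by (simp add: hyperboloid_time_def norm_Pair)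
      have "t \<le> norm (s, x + l *\<^sub>R (y - x)) + norm (0::real, l *\<^sub>R (y - x))"
        using norm_triangle_ineq4[of "(s, x + l *\<^sub>R (y - x))" "(0::real, l *\<^sub>R (y - x))"]
        by (simp add: t_eq time_norm)
      also have "norm (0::real, l *\<^sub>R (y - x)) \<le> norm (y - x)"
        using l by (simp add: norm_Pair mult_left_le_one_le)
      finally show ?thesis using h by (simp add: time_norm)
    qed
    have "\<bar>hyperboloid_restrict s u x\<bar> \<le> 5 * (\<Sum>J | length J \<le> 2.
      integral {0..1} (\<lambda>l. l * \<bar>hyperboloid_restrict s (boosts J u) (x + l *\<^sub>R (y - x))\<bar>))"
    proof (rule abs_restrict_le_segment_integral)
      show "s \<noteq> 0" using s by simp
    next
      fix l :: real assume "l \<in> {0..1}"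
      then show "u differentiable (at (hyperboloid_time s (x + l *\<^sub>R (y - x)), x + l *\<^sub>R (y - x)))"
        using diff[OF R_seg, of l "[]"] by (simp add: boosts_def)
    next
      fix l :: real and a assume "l \<in> {0..1}"
      then show "boost a u differentiable (at (hyperboloid_time s (x + l *\<^sub>R (y - x)), x + l *\<^sub>R (y - x)))"
        using diff[OF R_seg, of l "[a]"] by (simp add: boosts_def)
    next
      fix J :: "3 list"
      show "continuous_on {0..1} (\<lambda>l. hyperboloid_restrict s (boosts J u) (x + l *\<^sub>R (y - x)))"
      proof (rule continuous_on_compose2[OF cont[unfolded v_def]])
        show "continuous_on {0..1} (\<lambda>l. x + l *\<^sub>R (y - x))"
          by (intro continuous_intros)
        show "(\<lambda>l. x + l *\<^sub>R (y - x)) ` {0..1} \<subseteq> cball 0 R"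
          using R_seg by (auto simp only: mem_cball_0)
      qed
    qed (rule small)
    then show ?thesis by (simp add: v_def t_eq hyperboloid_restrict_def)
  qed
  have "sqrt (measure lborel D) * \<bar>u (t, x)\<bar>
      \<le> 2 / (4 - real DIM(real^3)) * 5 * (\<Sum>J | length J \<le> 2. sqrt (LINT z:D|lborel. \<bar>v J z\<bar>\<^sup>2))"
  proof (rule sobolev_of_segment_bounds)
    show "finite {J :: 3 list. length J \<le> 2}"
      using finite_lists_length_le[of "UNIV :: 3 set" 2] by simp
    show "continuous_on D (v J)" for J
      using continuous_on_subset[OF cont D_sub] .
    show "compact D" by (simp add: D_def)
  next
    fix y l assume "y \<in> D" "l \<in> {0..1::real}"
    then show "x + l *\<^sub>R (y - x) \<in> D" by (rule star)
  next
    fix y assume "y \<in> D"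
    then show "\<bar>u (t, x)\<bar> \<le> 5 * (\<Sum>J | length J \<le> 2.
        integral {0..1} (\<lambda>l. l * \<bar>v J (x + l *\<^sub>R (y - x))\<bar>))" by (rule bound)
  qed simp_all
  also have "\<dots> \<le> 10 * (\<Sum>J | length J \<le> 2. L2_norm_int s (boosts J u))"
  proof -
    have int: "set_integrable lborel S (\<lambda>z. \<bar>v J z\<bar>\<^sup>2)" if "compact S" "S \<subseteq> cball 0 R" for S J
      unfolding set_integrable_def
      by (intro borel_integrable_compact continuous_intros continuous_on_subset[OF cont] that)
    have "sqrt (LINT z:D|lborel. \<bar>v J z\<bar>\<^sup>2) \<le> L2_norm_int s (boosts J u)" for J
    proof -
      have "(LINT z:D|lborel. \<bar>v J z\<bar>\<^sup>2) \<le> (LINT z:cball 0 R|lborel. \<bar>v J z\<bar>\<^sup>2)"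
        using D_sub int[of D J] int[of "cball 0 R" J] unfolding set_lebesgue_integral_def set_integrable_def
        by (intro integral_mono) (auto simp: D_def indicator_def)
      moreover have "cball 0 R = {x :: real^3. norm x \<le> -1 + s\<^sup>2 / 2}"
        by (auto simp: R_def)
      ultimately show ?thesis
        by (simp add: L2_norm_int_def v_def hyperboloid_restrict_def hyperboloid_time_def)
    qed
    then show ?thesis by (simp add: sum_mono)
  qed
  finally have "sqrt (measure lborel D) * \<bar>u (t, x)\<bar>
      \<le> 10 * (\<Sum>J | length J \<le> 2. L2_norm_int s (boosts J u))" .
  moreover have "sqrt (measure lborel D) = sqrt (unit_ball_vol 3 / 64) * t powr (3 / 2)"
  proof -
    have "measure lborel D = unit_ball_vol 3 / 64 * t ^ 3"
      using \<rho> content_cball[of \<rho> c] by (simp add: D_def \<rho>_def power_divide)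
    moreover have "sqrt (t ^ 3) = t powr (3 / 2)"
      using t(1) powr_powr[of t 3 "1 / 2"] by (simp add: powr_half_sqrt)
    ultimately show ?thesis by (simp only: real_sqrt_mult)
  qed
  ultimately show ?thesis by (simp add: mult.assoc)
qed

theorem proposition2p2:
  shows "\<exists>C>0::real. \<forall>s\<ge>2::real. \<forall>(W :: spacetime set) (u :: spacetime \<Rightarrow> real).
    open W \<longrightarrow> hyperboloid_int s \<subseteq> W \<longrightarrow> smooth_on W u \<longrightarrow>
      (\<forall>(t, x) \<in> hyperboloid_int s.
        t powr (3 / 2) * \<bar>u (t, x)\<bar>
          \<le> C * (\<Sum>J | length J \<le> 2. L2_norm_int s (boosts J u)))"
proof -
  define \<kappa> where "\<kappa> = sqrt (unit_ball_vol 3 / 64)"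
  have "\<kappa> > 0" by (simp add: \<kappa>_def)
  then show ?thesis
  proof (intro exI[of _ "10 / \<kappa>"] conjI allI impI ballI, goal_cases)
    case (2 s W u p)
    obtain t x where p: "p = (t, x)" by (cases p)
    have "\<kappa> * (t powr (3 / 2) * \<bar>u (t, x)\<bar>)
        \<le> 10 * (\<Sum>J | length J \<le> 2. L2_norm_int s (boosts J u))"
      unfolding \<kappa>_def using 2 p by (intro sobolev_at_hyperboloid_point) simp_all
    then show ?case
      using \<open>\<kappa> > 0\<close> by (simp add: p pos_le_divide_eq mult.commute)
  qed simp
qed
end
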